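(* Consider a linear passive RLC network in impedance, admittance or hybrid form, of index 1 or index 2. Then the reciprocity of the descriptor system is preserved after applying the algorithm RPRBT-2 (positive real balanced truncation based on the generalized algebraic Riccati equation), even if the system is index-2. That is, the reduced-order transfer matrix $$\tilde G(s)=\tilde C_1S_1\left(s\tilde E_s-\tilde A_s\right)^{-1}\tilde B_1+M_0+sM_1$$ constructed in the context is symmetric for the impedance form and for the admittance form, and is block skew symmetric for the hybrid form.
   Context: All matrices are real. An $m\times m$ matrix ($m$ even) $H=\begin{bmatrix}H_{11}&H_{12}\\ H_{21}&H_{22}\end{bmatrix}$ with $m/2\times m/2$ blocks is called block skew symmetric if $H_{11}=H_{11}^T$, $H_{22}=H_{22}^T$, $H_{12}=-H_{21}^T$. Reciprocity means that the transfer matrix is symmetric (impedance, admittance) or block skew symmetric (hybrid). Network. Consider the descriptor system $E_0\,\frac{dx}{dt}=A_0x+B_0u$, $z=C_0x$, with $E_0,A_0\in\mathbb{R}^{n,n}$, $B_0\in\mathbb{R}^{n,m}$, $C_0\in\mathbb{R}^{m,n}$, $sE_0-A_0$ a regular pencil. Let $\mathcal{G},\mathcal{L},\mathcal{C}$ be the conductance, inductance and capacitance matrices (symmetric positive semidefinite), and $A_{\mathcal G},A_{\mathcal C},A_{\mathcal L},A_{\mathcal I},A_{\mathcal V}$ the incidence matrices to conductors, capacitors, inductors, independent current sources and independent voltage sources, of compatible sizes. $I_k$ is the $k\times k$ identity. Impedance form: $$E_0=\begin{bmatrix}A_{\mathcal C}\mathcal{C}A_{\mathcal C}^T&0\\ 0&-\mathcal{L}\end{bmatrix},\quad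 A_0=\begin{bmatrix}-A_{\mathcal G}\mathcal{G}A_{\mathcal G}^T&-A_{\mathcal L}\\ -A_{\mathcal L}^T&0\end{bmatrix},\quad B_0=\begin{bmatrix}-A_{\mathcal I}\\ 0\end{bmatrix},\quad C_0=B_0^T.$$ For the admittance and hybrid forms: $$E_0=\begin{bmatrix}A_{\mathcal C}\mathcal{C}A_{\mathcal C}^T&0&0\\ 0&-\mathcal{L}&0\\ 0&0&0\end{bmatrix},\quad A_0=\begin{bmatrix}-A_{\mathcal G}\mathcal{G}A_{\mathcal G}^T&-A_{\mathcal L}&-A_{\mathcal V}\\ -A_{\mathcal L}^T&0&0\\ -A_{\mathcal V}^T&0&0\end{bmatrix}.$$ Admittance form: $B_0=\begin{bmatrix}0\\ 0\\ I_m\end{bmatrix}$, $C_0=\begin{bmatrix}0&0&-I_m\end{bmatrix}$. Hybrid form ($m$ even): $B_0=\begin{bmatrix}-A_{\mathcal I}&0\\ 0&0\\ 0&I_{m/2}\end{bmatrix}$, $C_0=\begin{bmatrix}-A_{\mathcal I}^T&0&0\\ 0&0&-I_{m/2}\end{bmatrix}$. First transformation. Let $r_1,r_2$ be the ranks of $A_{\mathcal C}\mathcal{C}A_{\mathcal C}^T$ and $\mathcal{L}$, $r=r_1+r_2$, $I'_r=\mathrm{diag}(I_{r_1},-I_{r_2})$. By LDL factorization there is a nonsingular $V$ with $E_0=V\begin{bmatrix}I'_r&0\\ 0&0\end{bmatrix}V^T$. Partition conformably $$V^{-1}A_0V^{-T}=\begin{bmatrix}A_{11}&A_{12}\\ A_{21}&A_{22}\end{bmatrix},\quad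 V^{-1}B_0=\begin{bmatrix}B_1\\ B_2\end{bmatrix},\quad C_0V^{-T}=\begin{bmatrix}C_1&C_2\end{bmatrix}.$$ Second transformation. By LDL factorization $A_{22}=F\begin{bmatrix}S_{\bar r}&0\\ 0&0\end{bmatrix}F^T$ with $F$ nonsingular and $S_{\bar r}$ nonsingular symmetric of size $\bar r$. Write conformably $$A_{12}F^{-T}=\begin{bmatrix}A_{12,1}&A_{12,2}\end{bmatrix},\quad F^{-1}A_{21}=\begin{bmatrix}A_{21,1}\\ A_{21,2}\end{bmatrix},\quad F^{-1}B_2=\begin{bmatrix}B_{2,1}\\ B_{2,2}\end{bmatrix},\quad C_2F^{-T}=\begin{bmatrix}C_{2,1}&C_{2,2}\end{bmatrix},$$ and set $\bar A_{11}=A_{11}-A_{12,1}S_{\bar r}^{-1}A_{21,1}$, $\bar A_{12}=A_{12,2}$, $\bar A_{21}=A_{21,2}$, $\bar B_1=B_1-A_{12,1}S_{\bar r}^{-1}B_{2,1}$, $\bar B_2=B_{2,2}$, $\bar C_1=C_1-C_{2,1}S_{\bar r}^{-1}A_{21,1}$, $\bar C_2=C_{2,2}$, $\bar D_0=-C_{2,1}S_{\bar r}^{-1}B_{2,1}$. Index-2 case ($A_{22}$ singular): $$\bar E_0=\begin{bmatrix}I'_r&0\\ 0&0\end{bmatrix},\quad \bar A_0=\begin{bmatrix}\bar A_{11}&\bar A_{12}\\ \bar A_{21}&0\end{bmatrix},\quad \bar B_0=\begin{bmatrix}\bar B_1\\ \bar B_2\end{bmatrix},\quad \bar C_0=\begin{bmatrix}\bar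 C_1&\bar C_2\end{bmatrix},$$ where $\bar A_{21}I'_r\bar A_{12}$ is assumed nonsingular. With $\Pi_l=I_r-\bar A_{12}(\bar A_{21}I'_r\bar A_{12})^{-1}\bar A_{21}I'_r$ and $\Pi_r=I_r-I'_r\bar A_{12}(\bar A_{21}I'_r\bar A_{12})^{-1}\bar A_{21}$, the spectral projectors are $$P_l=\begin{bmatrix}\Pi_l&-\Pi_l\bar A_{11}I'_r\bar A_{12}(\bar A_{21}I'_r\bar A_{12})^{-1}\\ 0&0\end{bmatrix},\quad P_r=\begin{bmatrix}\Pi_r&0\\ -(\bar A_{21}I'_r\bar A_{12})^{-1}\bar A_{21}I'_r\bar A_{11}\Pi_r&0\end{bmatrix}.$$ Index-1 case ($A_{22}$ nonsingular): $\bar E_0=I'_r$, $\bar A_0=\bar A_{11}$, $\bar B_0=\bar B_1$, $\bar C_0=\bar C_1$, $P_l=P_r=I_r$, $M_0=\bar D_0$, $M_1=0$. Polynomial part. The transfer matrix $G(s)=\bar C_0(s\bar E_0-\bar A_0)^{-1}\bar B_0+\bar D_0$ (equal to that of the original system) decomposes uniquely as $G(s)=G_{sp}(s)+M_0+sM_1$ with $G_{sp}$ strictly proper and $M_0,M_1$ constant matrices. (When $\bar A_0$ is nonsingular, $M_0=-\bar C_0(I-P_r)\bar A_0^{-1}(I-P_l)\bar B_0+\bar D_0$ and $M_1=-\bar C_0\bar A_0^{-1}(I-P_l)\bar E_0(I-P_r)\bar A_0^{-1}\bar B_0$.) It is assumed that $M_0+M_0^T$ is positive definite. Algorithm RPRBT-2.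 Put $E=\bar E_0$, $DD^T=(M_0+M_0^T)^{-1}$, $A_1=\bar A_0-\bar B_0DD^T\bar C_0P_r$, $B=\bar B_0D$, $C=D^T\bar C_0$. Let $X$ be a symmetric positive semidefinite solution of $$A_1^TXE+E^TXA_1+E^TXBB^TXE+P_r^TC^TCP_r=0,$$ factored as $X=QQ^T$. Take an eigenvalue decomposition $Q^T\bar E_0Q=U\Sigma U^T=U|\Sigma|SU^T$ with $U$ orthogonal, $\Sigma$ diagonal with entries in descending order of absolute value, and $S$ the diagonal matrix of the signs of the entries of $\Sigma$. Partition $\Sigma=\mathrm{diag}(\Sigma_1,\Sigma_2)$, $S=\mathrm{diag}(S_1,S_2)$, $U=\begin{bmatrix}U_1&U_2\end{bmatrix}$ conformably, where the retained values, in $\Sigma_1$, are nonzero. Define $$\tilde E_s=|\Sigma_1|^{-1/2}U_1^TQ^T\bar E_0QU_1|\Sigma_1|^{-1/2},\quad \tilde A_s=|\Sigma_1|^{-1/2}U_1^TQ^T\bar A_0QU_1|\Sigma_1|^{-1/2},$$ $$\tilde B_1=|\Sigma_1|^{-1/2}U_1^TQ^T\bar B_0,\quad \tilde C_1=\bar C_0QU_1S_1|\Sigma_1|^{-1/2}.$$ The reduced-order model is $(\tilde E_sS_1,\tilde A_sS_1,\tilde B_1,\tilde C_1,M_0,M_1)$, with transfer matrix $\tilde G(s)$ as in the claim (a rational matrix function of $s$). *)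

theory Defs
  imports
    "Jordan_Normal_Form.Determinant"
    "Jordan_Normal_Form.Gauss_Jordan_Elimination"
    "Jordan_Normal_Form.DL_Rank"
begin

section \<open>Matrices\<close>

text \<open>Matrices have explicit, possibly zero, dimensions.  Hence empty blocks are allowed; a network
  without inductors, for instance, has an inductance matrix of size 0.\<close>

definition inv_mat :: "'a :: field mat \<Rightarrow> 'a mat" where
  "inv_mat A = the (mat_inverse A)"

text \<open>Horizontal counterpart of \<^const>\<open>append_rows\<close>.\<close>

definition append_cols :: "'a :: zero mat \<Rightarrow> 'a mat \<Rightarrow> 'a mat" (infixr "@\<^sub>c" 65) where
  "A @\<^sub>c B = four_block_mat A B (0\<^sub>m 0 (dim_col A)) (0\<^sub>m 0 (dim_col B))"

definition symmetric_mat :: "'a mat \<Rightarrow> bool" where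
  "symmetric_mat A \<longleftrightarrow> A\<^sup>T = A"

definition block_skew_symmetric :: "'a :: ring_1 mat \<Rightarrow> bool" where
  "block_skew_symmetric H \<longleftrightarrow> (\<exists>p H11 H12 H21 H22.
     H11 \<in> carrier_mat p p \<and> H12 \<in> carrier_mat p p \<and>
     H21 \<in> carrier_mat p p \<and> H22 \<in> carrier_mat p p \<and>
     H = four_block_mat H11 H12 H21 H22 \<and>
     H11 = H11\<^sup>T \<and> H22 = H22\<^sup>T \<and> H12 = - H21\<^sup>T)"

definition psd_mat :: "nat \<Rightarrow> real mat \<Rightarrow> bool" where
  "psd_mat n A \<longleftrightarrow> A \<in> carrier_mat n n \<and> symmetric_mat A \<and>
     (\<forall>x \<in> carrier_vec n. 0 \<le> x \<bullet> (A *\<^sub>v x))"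

definition pd_mat :: "nat \<Rightarrow> real mat \<Rightarrow> bool" where
  "pd_mat n A \<longleftrightarrow> A \<in> carrier_mat n n \<and> symmetric_mat A \<and>
     (\<forall>x \<in> carrier_vec n. x \<noteq> 0\<^sub>v n \<longrightarrow> 0 < x \<bullet> (A *\<^sub>v x))"

text \<open>The matrix \<open>diag(I, -I)\<close> with blocks of sizes \<open>r1\<close> and \<open>r2\<close>.\<close>

definition sign_mat :: "nat \<Rightarrow> nat \<Rightarrow> real mat" where
  "sign_mat r1 r2 = four_block_mat (1\<^sub>m r1) (0\<^sub>m r1 r2) (0\<^sub>m r2 r1) (- 1\<^sub>m r2)"


section \<open>Pencils and transfer matrices\<close>

abbreviation cmat :: "real mat \<Rightarrow> complex mat" where
  "cmat \<equiv> map_mat complex_of_real"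

definition pencil :: "real mat \<Rightarrow> real mat \<Rightarrow> complex \<Rightarrow> complex mat" where
  "pencil E A s = s \<cdot>\<^sub>m cmat E - cmat A"

definition regular_pencil :: "nat \<Rightarrow> real mat \<Rightarrow> real mat \<Rightarrow> bool" where
  "regular_pencil n E A \<longleftrightarrow> E \<in> carrier_mat n n \<and> A \<in> carrier_mat n n \<and>
     (\<exists>s. det (pencil E A s) \<noteq> 0)"

text \<open>\<open>C (s E - A)\<^sup>-\<^sup>1 B\<close>; meaningful only where \<open>det (s E - A) \<noteq> 0\<close>, i.e. for a regular pencil
  at all but finitely many \<open>s\<close>.\<close>

definition resolvent_transfer ::
  "real mat \<Rightarrow> real mat \<Rightarrow> real mat \<Rightarrow> real mat \<Rightarrow> complex \<Rightarrow> complex mat" where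
  "resolvent_transfer E A B C s = cmat C * inv_mat (pencil E A s) * cmat B"

text \<open>A rational matrix function is strictly proper iff it vanishes at infinity.  The definition
  is applied to \<open>G(s) - M0 - s M1\<close> with rational \<open>G\<close> only, and the values of \<open>G\<close> at its finitely many
  poles do not matter.\<close>

definition strictly_proper :: "nat \<Rightarrow> (complex \<Rightarrow> complex mat) \<Rightarrow> bool" where
  "strictly_proper m H \<longleftrightarrow> (\<forall>s. H s \<in> carrier_mat m m) \<and>
     (\<forall>i<m. \<forall>j<m. ((\<lambda>s. H s $$ (i, j)) \<longlongrightarrow> 0) at_infinity)"

definition polynomial_part ::
  "nat \<Rightarrow> (complex \<Rightarrow> complex mat) \<Rightarrow> real mat \<Rightarrow> real mat \<Rightarrow> bool" where
  "polynomial_part m G M0 M1 \<longleftrightarrow> M0 \<in> carrier_mat m m \<and> M1 \<in> carrier_mat m m \<and>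
     strictly_proper m (\<lambda>s. G s - (cmat M0 + s \<cdot>\<^sub>m cmat M1))"


section \<open>RLC networks\<close>

text \<open>Branch \<open>j\<close> leads from node \<open>tail j\<close> to node \<open>head j\<close>.  A node number \<open>\<ge> nv\<close> stands for a
  reference node whose row has been deleted, so the full incidence matrix is covered as well.\<close>

definition incidence_matrix :: "nat \<Rightarrow> real mat \<Rightarrow> bool" where
  "incidence_matrix nv A \<longleftrightarrow> dim_row A = nv \<and>
     (\<exists>tail head :: nat \<Rightarrow> nat. \<forall>i<nv. \<forall>j<dim_col A.
        A $$ (i, j) = (if tail j = i then 1 else 0) - (if head j = i then 1 else 0))"

text \<open>The form of the network, with the incidence matrices of its independent sources:
  current sources (impedance), voltage sources (admittance), current and voltage sources
  (hybrid).\<close>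

datatype ports = Impedance "real mat" | Admittance "real mat" | Hybrid "real mat" "real mat"

fun valid_ports :: "nat \<Rightarrow> ports \<Rightarrow> bool" where
  "valid_ports nv (Impedance AI) \<longleftrightarrow> incidence_matrix nv AI"
| "valid_ports nv (Admittance AV) \<longleftrightarrow> incidence_matrix nv AV"
| "valid_ports nv (Hybrid AI AV) \<longleftrightarrow>
     incidence_matrix nv AI \<and> incidence_matrix nv AV \<and> dim_col AI = dim_col AV"

definition core_E :: "real mat \<Rightarrow> real mat \<Rightarrow> real mat \<Rightarrow> real mat" where
  "core_E AC Cm Lm = four_block_mat
     (AC * Cm * AC\<^sup>T)                       (0\<^sub>m (dim_row AC) (dim_row Lm))
     (0\<^sub>m (dim_row Lm) (dim_row AC))       (- Lm)"

definition core_A :: "real mat \<Rightarrow> real mat \<Rightarrow> real mat \<Rightarrow> real mat" where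
  "core_A AG Gm AL = four_block_mat
     (- (AG * Gm * AG\<^sup>T))   (- AL)
     (- AL\<^sup>T)               (0\<^sub>m (dim_col AL) (dim_col AL))"

definition bordered_E :: "real mat \<Rightarrow> real mat \<Rightarrow> real mat \<Rightarrow> real mat \<Rightarrow> real mat" where
  "bordered_E AC Cm Lm AV = (let p = dim_col AV; k = dim_row (core_E AC Cm Lm) in
     four_block_mat (core_E AC Cm Lm) (0\<^sub>m k p) (0\<^sub>m p k) (0\<^sub>m p p))"

definition bordered_A :: "real mat \<Rightarrow> real mat \<Rightarrow> real mat \<Rightarrow> real mat \<Rightarrow> real mat" where
  "bordered_A AG Gm AL AV = (let p = dim_col AV; nL = dim_col AL in
     four_block_mat
       (core_A AG Gm AL)              (- AV @\<^sub>r 0\<^sub>m nL p)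
       (- AV\<^sup>T @\<^sub>c 0\<^sub>m p nL)    (0\<^sub>m p p))"

fun network_E :: "real mat \<Rightarrow> real mat \<Rightarrow> real mat \<Rightarrow> ports \<Rightarrow> real mat" where
  "network_E AC Cm Lm (Impedance AI) = core_E AC Cm Lm"
| "network_E AC Cm Lm (Admittance AV) = bordered_E AC Cm Lm AV"
| "network_E AC Cm Lm (Hybrid AI AV) = bordered_E AC Cm Lm AV"

fun network_A :: "real mat \<Rightarrow> real mat \<Rightarrow> real mat \<Rightarrow> ports \<Rightarrow> real mat" where
  "network_A AG Gm AL (Impedance AI) = core_A AG Gm AL"
| "network_A AG Gm AL (Admittance AV) = bordered_A AG Gm AL AV"
| "network_A AG Gm AL (Hybrid AI AV) = bordered_A AG Gm AL AV"

text \<open>\<open>nL\<close> is the number of inductors.\<close>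

fun network_B :: "nat \<Rightarrow> ports \<Rightarrow> real mat" where
  "network_B nL (Impedance AI) = - AI @\<^sub>r 0\<^sub>m nL (dim_col AI)"
| "network_B nL (Admittance AV) = (let m = dim_col AV in
     0\<^sub>m (dim_row AV) m @\<^sub>r 0\<^sub>m nL m @\<^sub>r 1\<^sub>m m)"
| "network_B nL (Hybrid AI AV) = (let p = dim_col AV; k = dim_row AI + nL in
     four_block_mat
       (- AI @\<^sub>r 0\<^sub>m nL p)   (0\<^sub>m k p)
       (0\<^sub>m p p)                  (1\<^sub>m p))"

fun network_C :: "nat \<Rightarrow> ports \<Rightarrow> real mat" where
  "network_C nL (Impedance AI) = (network_B nL (Impedance AI))\<^sup>T"
| "network_C nL (Admittance AV) = (let m = dim_col AV in
     0\<^sub>m m (dim_row AV) @\<^sub>c 0\<^sub>m m nL @\<^sub>c - 1\<^sub>m m)"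
| "network_C nL (Hybrid AI AV) = (let p = dim_col AV; k = dim_row AI + nL in
     four_block_mat
       (- AI\<^sup>T @\<^sub>c 0\<^sub>m p nL)   (0\<^sub>m p p)
       (0\<^sub>m p k)                       (- 1\<^sub>m p))"


section \<open>Spectral projector of the index-2 system\<close>

text \<open>Here \<open>Ir\<close> is the leading (signature) block of the matrix \<open>E\<close> and \<open>A11, A12, A21\<close> are the
  nonzero blocks of the matrix \<open>A\<close>.\<close>

definition proj_Pi_r :: "real mat \<Rightarrow> real mat \<Rightarrow> real mat \<Rightarrow> real mat" where
  "proj_Pi_r Ir A12 A21 =
     1\<^sub>m (dim_row Ir) - Ir * A12 * inv_mat (A21 * Ir * A12) * A21"

definition proj_P_r :: "real mat \<Rightarrow> real mat \<Rightarrow> real mat \<Rightarrow> real mat \<Rightarrow> real mat" where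
  "proj_P_r Ir A11 A12 A21 = (let r = dim_row Ir; q = dim_col A12 in
     four_block_mat
       (proj_Pi_r Ir A12 A21)
       (0\<^sub>m r q)
       (- (inv_mat (A21 * Ir * A12) * A21 * Ir * A11 * proj_Pi_r Ir A12 A21))
       (0\<^sub>m q q))"

end

theory Submission
  imports Defs "Jordan_Normal_Form.Spectral_Radius"
begin

text \<open>Reciprocity is a symmetry statement about one fixed signature matrix \<open>J\<close> on the ports, with
  \<open>J\<^sup>2 = I\<close>: put \<open>J = I\<close> for the impedance form, \<open>J = -I\<close> for the admittance form and
  \<open>J = diag(I, -I)\<close> for the hybrid form (\<open>port_signature\<close>).  In all three cases the matrices \<open>E\<^sub>0\<close>
  and \<open>A\<^sub>0\<close> are symmetric and \<open>C\<^sub>0 = J B\<^sub>0\<^sup>T\<close> (\<open>symmetric_network_A\<close>, \<open>network_C_eq\<close>).  Any system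
  \<open>(E, A, B, J B\<^sup>T)\<close> with symmetric \<open>E\<close> and \<open>A\<close> is reciprocal, since
  \<open>J (J B\<^sup>T) (s E - A)\<^sup>-\<^sup>1 B = B\<^sup>T (s E - A)\<^sup>-\<^sup>1 B\<close> is symmetric (\<open>reciprocal_resolvent\<close>); and
  that \<open>J H\<close> is symmetric means that \<open>H\<close> is symmetric if \<open>J = \<plusminus>I\<close>, and block skew symmetric if
  \<open>J = diag(I, -I)\<close>.

  The structure "\<open>E\<close>, \<open>A\<close> symmetric and \<open>C = J B\<^sup>T\<close>" survives each step of the algorithm.  The
  first transformation turns \<open>E\<^sub>0\<close> into a signature matrix, bordered by zeros.  Both transformations
  are congruences followed by a partition (\<open>reciprocal_ports_split\<close>), and the elimination of the
  block \<open>S\<close> is a Schur complement (\<open>reciprocal_schur\<close>, \<open>reciprocal_feedthrough\<close>).  The reduction by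
  balancing is again a congruence: with \<open>W = Q U\<^sub>1 |\<Sigma>\<^sub>1|\<^sup>-\<^sup>1\<^sup>/\<^sup>2\<close> the reduced matrices are \<open>W\<^sup>T E W\<close>,
  \<open>W\<^sup>T A W\<close>, \<open>W\<^sup>T B\<close>, and the two factors \<open>S\<^sub>1\<close> in the output matrix cancel, so that it equals
  \<open>C W = J (W\<^sup>T B)\<^sup>T\<close>.

  The polynomial part \<open>M\<^sub>0 + s M\<^sub>1\<close> is reciprocal because it is determined by the transfer matrix:
  the antisymmetric part of \<open>J (M\<^sub>0 + s M\<^sub>1)\<close> is affine in \<open>s\<close> and agrees near infinity, up to sign,
  with that of a strictly proper function, hence vanishes (\<open>reciprocal_polynomial_part\<close>).  This uses that the
  index-2 pencil is nonsingular near infinity (\<open>index2_pencil_det\<close>).  Finally, the balanced matrix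
  \<open>W\<^sup>T E W\<close> is the sign matrix \<open>S\<^sub>1\<close> (\<open>balanced_leading_block\<close>), an involution, which makes the
  reduced pencil regular.\<close>


section \<open>Matrix products, inverses and symmetry\<close>

text \<open>Associativity and transposition laws conditioned on dimensions, so that rewriting can discharge
  the side conditions without being given the intermediate sizes.\<close>

lemma mult_assoc_dims:
  fixes A :: "'a :: semiring_0 mat"
  assumes "dim_col A = dim_row B" "dim_col B = dim_row C"
  shows "A * B * C = A * (B * C)"
  using assms by (intro assoc_mult_mat) auto

lemma mult_mat_vec_assoc_dims:
  fixes A :: "'a :: semiring_0 mat"
  assumes "dim_col A = dim_row B" "dim_col B = dim_vec v"
  shows "A * B *\<^sub>v v = A *\<^sub>v (B *\<^sub>v v)"
  using assms by (intro assoc_mult_mat_vec) auto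

lemma mult_mat_zero_vec:
  fixes A :: "'a :: semiring_0 mat"
  assumes "A \<in> carrier_mat nr nc"
  shows "A *\<^sub>v 0\<^sub>v nc = 0\<^sub>v nr"
  using assms by (intro eq_vecI) (auto simp: scalar_prod_def)

lemma transpose_mult_dims:
  fixes A :: "'a :: comm_semiring_0 mat"
  assumes "dim_col A = dim_row B"
  shows "(A * B)\<^sup>T = B\<^sup>T * A\<^sup>T"
  using assms by (intro transpose_mult) auto

lemma cmat_mult:
  assumes "dim_col A = dim_row B"
  shows "cmat (A * B) = cmat A * cmat B"
  using assms by (intro eq_matI) (auto simp: scalar_prod_def)

lemma cmat_transpose: "cmat (A\<^sup>T) = (cmat A)\<^sup>T"
  by (intro eq_matI) auto

lemma cmat_one: "cmat (1\<^sub>m n) = 1\<^sub>m n"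
  by (intro eq_matI) auto

lemma inv_mat_inverts:
  fixes A :: "'a :: field mat"
  assumes A: "A \<in> carrier_mat n n" and det: "det A \<noteq> 0"
  shows "inv_mat A \<in> carrier_mat n n" "A * inv_mat A = 1\<^sub>m n" "inv_mat A * A = 1\<^sub>m n"
proof -
  from mat_inverse(1)[OF A, of undefined] det_non_zero_imp_unit[OF A det, of undefined]
  obtain B where B: "mat_inverse A = Some B" by (cases "mat_inverse A") auto
  from mat_inverse(2)[OF A B] B
  show "inv_mat A \<in> carrier_mat n n" "A * inv_mat A = 1\<^sub>m n" "inv_mat A * A = 1\<^sub>m n"
    by (auto simp: inv_mat_def)
qed

lemma invertible_mat_det:
  fixes A :: "'a :: field mat"
  assumes A: "A \<in> carrier_mat n n" and inv: "invertible_mat A"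
  shows "det A \<noteq> 0"
proof -
  from inv obtain B where AB: "A * B = 1\<^sub>m (dim_row A)" and BA: "B * A = 1\<^sub>m (dim_row B)"
    by (auto simp: invertible_mat_def inverts_mat_def)
  have "B \<in> carrier_mat n n"
    using arg_cong[OF AB, of dim_col] arg_cong[OF BA, of dim_col] A by auto
  from det_mult[OF A this] AB A have "det A * det B = 1" by simp
  thus ?thesis by auto
qed

lemma symmetric_matD:
  assumes "symmetric_mat A" "A \<in> carrier_mat n n" "i < n" "j < n"
  shows "A $$ (i, j) = A $$ (j, i)"
  using assms index_transpose_mat(1)[of j A i] unfolding symmetric_mat_def by auto

lemma symmetric_mat_add:
  assumes "A \<in> carrier_mat n n" "B \<in> carrier_mat n n" "symmetric_mat A" "symmetric_mat B"
  shows "symmetric_mat (A + B)"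
  using assms by (simp add: symmetric_mat_def transpose_add[of _ n n])

lemma symmetric_mat_smult: "symmetric_mat A \<Longrightarrow> symmetric_mat (c \<cdot>\<^sub>m A)"
proof -
  have "(c \<cdot>\<^sub>m A)\<^sup>T = c \<cdot>\<^sub>m A\<^sup>T" by (intro eq_matI) auto
  thus "symmetric_mat A \<Longrightarrow> symmetric_mat (c \<cdot>\<^sub>m A)" by (simp add: symmetric_mat_def)
qed

lemma symmetric_cmat: "symmetric_mat A \<Longrightarrow> symmetric_mat (cmat A)"
  unfolding symmetric_mat_def by (simp flip: cmat_transpose)

lemma symmetric_mat_mult_transpose:
  fixes A :: "'a :: comm_semiring_0 mat"
  assumes "A \<in> carrier_mat n n" "symmetric_mat A" "dim_col T = n"
  shows "symmetric_mat (T * A * T\<^sup>T)"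
  using assms by (simp add: symmetric_mat_def transpose_mult_dims mult_assoc_dims)

lemma symmetric_inv_mat:
  fixes A :: "'a :: field mat"
  assumes A: "A \<in> carrier_mat n n" and det: "det A \<noteq> 0" and sym: "symmetric_mat A"
  shows "symmetric_mat (inv_mat A)"
proof -
  note inv = inv_mat_inverts[OF A det]
  have "(inv_mat A)\<^sup>T * A = (A * inv_mat A)\<^sup>T"
    using inv(1) A sym by (simp add: symmetric_mat_def transpose_mult_dims)
  hence "(inv_mat A)\<^sup>T * A = 1\<^sub>m n" by (simp add: inv)
  hence "(inv_mat A)\<^sup>T * A * inv_mat A = inv_mat A" using inv(1) by simp
  thus ?thesis using inv A by (simp add: symmetric_mat_def mult_assoc_dims)
qed


section \<open>Block matrices\<close>

lemma append_rows_transpose: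
  assumes "dim_col A = dim_col B"
  shows "(A @\<^sub>r B)\<^sup>T = A\<^sup>T @\<^sub>c B\<^sup>T"
  using assms by (intro eq_matI) (auto simp: append_rows_def append_cols_def)

lemma mult_append_cols:
  assumes "dim_row A = dim_col J" "dim_row B = dim_col J"
  shows "J * (A @\<^sub>c B) = (J * A) @\<^sub>c (J * B)"
  using assms
  by (intro eq_matI) (auto simp: append_cols_def scalar_prod_def)

lemma four_block_mat_inject:
  assumes "A \<in> carrier_mat a c" "B \<in> carrier_mat a d" "C \<in> carrier_mat b c" "D \<in> carrier_mat b d"
    and "A' \<in> carrier_mat a c" "B' \<in> carrier_mat a d" "C' \<in> carrier_mat b c" "D' \<in> carrier_mat b d"
    and eq: "four_block_mat A B C D = four_block_mat A' B' C' D'"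
  shows "A = A'" "B = B'" "C = C'" "D = D'"
proof -
  have ix: "four_block_mat A B C D $$ (i, j) = four_block_mat A' B' C' D' $$ (i, j)" for i j
    by (simp only: eq)
  show "A = A'"
  proof (intro eq_matI)
    fix i j assume "i < dim_row A'" "j < dim_col A'"
    with ix[of i j] assms(1-8) show "A $$ (i, j) = A' $$ (i, j)" by simp
  qed (use assms(1-8) in auto)
  show "B = B'"
  proof (intro eq_matI)
    fix i j assume "i < dim_row B'" "j < dim_col B'"
    with ix[of i "c + j"] assms(1-8) show "B $$ (i, j) = B' $$ (i, j)" by simp
  qed (use assms(1-8) in auto)
  show "C = C'"
  proof (intro eq_matI)
    fix i j assume "i < dim_row C'" "j < dim_col C'"
    with ix[of "a + i" j] assms(1-8) show "C $$ (i, j) = C' $$ (i, j)" by simp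
  qed (use assms(1-8) in auto)
  show "D = D'"
  proof (intro eq_matI)
    fix i j assume "i < dim_row D'" "j < dim_col D'"
    with ix[of "a + i" "c + j"] assms(1-8) show "D $$ (i, j) = D' $$ (i, j)" by simp
  qed (use assms(1-8) in auto)
qed

lemma append_cols_inject:
  assumes "A \<in> carrier_mat a c" "B \<in> carrier_mat a d" "A' \<in> carrier_mat a c" "B' \<in> carrier_mat a d"
    and "A @\<^sub>c B = A' @\<^sub>c B'"
  shows "A = A'" "B = B'"
  using four_block_mat_inject[of A a c B d "0\<^sub>m 0 c" 0 "0\<^sub>m 0 d" A' B' "0\<^sub>m 0 c" "0\<^sub>m 0 d"] assms
  by (auto simp: append_cols_def)

text \<open>Reads off the symmetries of the blocks from that of the whole matrix, which is how they are known
  after a transformation.\<close>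

lemma symmetric_four_block_iff:
  assumes "A \<in> carrier_mat a a" "B \<in> carrier_mat a b" "C \<in> carrier_mat b a" "D \<in> carrier_mat b b"
  shows "symmetric_mat (four_block_mat A B C D) \<longleftrightarrow> symmetric_mat A \<and> C = B\<^sup>T \<and> symmetric_mat D"
proof
  assume "symmetric_mat (four_block_mat A B C D)"
  hence "four_block_mat A\<^sup>T C\<^sup>T B\<^sup>T D\<^sup>T = four_block_mat A B C D"
    by (simp add: symmetric_mat_def transpose_four_block_mat[OF assms])
  from four_block_mat_inject[OF _ _ _ _ assms this] assms
  show "symmetric_mat A \<and> C = B\<^sup>T \<and> symmetric_mat D" by (auto simp: symmetric_mat_def)
next
  assume "symmetric_mat A \<and> C = B\<^sup>T \<and> symmetric_mat D"
  thus "symmetric_mat (four_block_mat A B C D)"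
    using transpose_four_block_mat[OF assms] by (simp add: symmetric_mat_def)
qed


section \<open>Preservation of reciprocity by congruences and Schur complements\<close>

text \<open>\<open>C T\<^sup>T = J B\<^sup>T T\<^sup>T = J (T B)\<^sup>T\<close>, so a congruence by \<open>T\<close> keeps the relation between the input and
  the output matrix, and partitioning rows of the one and columns of the other keeps it blockwise.
  For \<open>J = I\<close> this also covers off-diagonal blocks of a symmetric matrix.\<close>

lemma reciprocal_ports_split:
  fixes J :: "'a :: comm_semiring_0 mat"
  assumes J: "J \<in> carrier_mat m m" and T: "T \<in> carrier_mat n n" and B: "B \<in> carrier_mat n m"
    and C: "C = J * B\<^sup>T"
    and TB: "T * B = B1 @\<^sub>r B2" and CT: "C * T\<^sup>T = C1 @\<^sub>c C2"
    and B12: "B1 \<in> carrier_mat p m" "B2 \<in> carrier_mat q m"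
    and C12: "C1 \<in> carrier_mat m p" "C2 \<in> carrier_mat m q"
  shows "C1 = J * B1\<^sup>T" "C2 = J * B2\<^sup>T"
proof -
  have "C1 @\<^sub>c C2 = J * (T * B)\<^sup>T"
    using J T B by (simp add: CT[symmetric] C transpose_mult_dims mult_assoc_dims)
  also have "\<dots> = (J * B1\<^sup>T) @\<^sub>c (J * B2\<^sup>T)"
    using B12 J by (simp add: TB append_rows_transpose mult_append_cols)
  finally have eq: "C1 @\<^sub>c C2 = (J * B1\<^sup>T) @\<^sub>c (J * B2\<^sup>T)" .
  show "C1 = J * B1\<^sup>T" "C2 = J * B2\<^sup>T"
    by (rule append_cols_inject[OF C12 _ _ eq]; use J B12 in auto)+
qed

text \<open>The correction terms of the eliminated block are \<open>J\<close>-transposes of each other: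
  \<open>C\<^sub>2 K A\<^sub>2\<^sub>1 = J B\<^sub>2\<^sup>T K A\<^sub>1\<^sub>2\<^sup>T = J (A\<^sub>1\<^sub>2 K B\<^sub>2)\<^sup>T\<close>, where \<open>K\<close> is the inverse of that block.\<close>

lemma reciprocal_schur:
  fixes J :: "'a :: comm_ring mat"
  assumes "J \<in> carrier_mat m m" "K \<in> carrier_mat s s" "symmetric_mat K"
    "B1 \<in> carrier_mat p m" "B2 \<in> carrier_mat s m" "A12 \<in> carrier_mat p s"
    and "C1 = J * B1\<^sup>T" "C2 = J * B2\<^sup>T" "A21 = A12\<^sup>T"
  shows "C1 - C2 * K * A21 = J * (B1 - A12 * K * B2)\<^sup>T"
proof -
  have "(B1 - A12 * K * B2)\<^sup>T = B1\<^sup>T - B2\<^sup>T * K * A12\<^sup>T"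
    using assms transpose_minus[of B1 p m "A12 * K * B2"]
    by (simp add: symmetric_mat_def transpose_mult_dims mult_assoc_dims)
  moreover have "J * (B1\<^sup>T - B2\<^sup>T * K * A12\<^sup>T) = J * B1\<^sup>T - J * (B2\<^sup>T * K * A12\<^sup>T)"
    using assms by (intro mult_minus_distrib_mat) auto
  ultimately show ?thesis using assms by (simp add: mult_assoc_dims)
qed

text \<open>The two signatures meet and cancel: \<open>J (C K B) = J J B\<^sup>T K B = B\<^sup>T K B\<close>.\<close>

lemma reciprocal_feedthrough:
  fixes J :: "'a :: comm_ring_1 mat"
  assumes "J \<in> carrier_mat m m" "J * J = 1\<^sub>m m" "K \<in> carrier_mat s s" "symmetric_mat K"
    and "B \<in> carrier_mat s m" "C = J * B\<^sup>T"
  shows "symmetric_mat (J * - (C * K * B))"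
proof -
  have "J * - (C * K * B) = - (J * J * (B\<^sup>T * K * B))"
    using assms(1,3,5) by (simp add: assms(6) mult_assoc_dims)
  also have "\<dots> = - (B\<^sup>T * K * B)" using assms(2,3,5) by simp
  finally show ?thesis
    using symmetric_mat_mult_transpose[OF assms(3,4), of "B\<^sup>T"] assms(5)
    by (simp add: symmetric_mat_def transpose_uminus)
qed


section \<open>Pencils near infinity\<close>

lemma finite_eigenvalues:
  fixes A :: "'a :: field mat"
  assumes "A \<in> carrier_mat n n"
  shows "finite {s. eigenvalue A s}"
  using card_finite_spectrum(1)[OF assms] by (simp add: spectrum_def)

lemma eventually_not_eigenvalue:
  assumes "A \<in> carrier_mat n n"
  shows "eventually (\<lambda>s::complex. \<not> eigenvalue A s) at_infinity"
proof -
  have "eventually (\<lambda>s. \<forall>t \<in> {s. eigenvalue A s}. s \<noteq> t) at_infinity"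
    using finite_eigenvalues[OF assms]
    by (intro eventually_ball_finite) (auto intro: eventually_not_equal_at_infinity)
  thus ?thesis by eventually_elim auto
qed

text \<open>A kernel vector \<open>(x, z)\<close> of the pencil satisfies \<open>s I\<^sub>r x = A\<^sub>1\<^sub>1 x + A\<^sub>1\<^sub>2 z\<close> and \<open>A\<^sub>2\<^sub>1 x = 0\<close>.
  Multiplying the first equation by \<open>A\<^sub>2\<^sub>1 I\<^sub>r\<close> determines \<open>z\<close> from \<open>x\<close>, because \<open>A\<^sub>2\<^sub>1 I\<^sub>r A\<^sub>1\<^sub>2\<close> is
  invertible; inserting \<open>z\<close> turns the first equation into \<open>T x = s x\<close> for a matrix \<open>T\<close> that does not
  depend on \<open>s\<close>.  Hence the pencil is singular only at eigenvalues of \<open>T\<close>, which are finite in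
  number.\<close>

lemma index2_pencil_det:
  assumes Ir: "Ir \<in> carrier_mat r r" "Ir * Ir = 1\<^sub>m r"
    and A: "A11 \<in> carrier_mat r r" "A12 \<in> carrier_mat r q" "A21 \<in> carrier_mat q r"
    and inv: "invertible_mat (A21 * Ir * A12)"
  shows "eventually (\<lambda>s. det (pencil (four_block_mat Ir (0\<^sub>m r q) (0\<^sub>m q r) (0\<^sub>m q q))
      (four_block_mat A11 A12 A21 (0\<^sub>m q q)) s) \<noteq> 0) at_infinity"
proof -
  let ?E = "four_block_mat Ir (0\<^sub>m r q) (0\<^sub>m q r) (0\<^sub>m q q)"
  let ?A = "four_block_mat A11 A12 A21 (0\<^sub>m q q)"
  have "A21 * Ir * A12 \<in> carrier_mat q q" using Ir A by auto
  note W = inv_mat_inverts[OF this invertible_mat_det[OF this inv]]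
  define W where "W = cmat (inv_mat (A21 * Ir * A12))"
  define a11 a12 a21 I' where a: "a11 = cmat A11" "a12 = cmat A12" "a21 = cmat A21" "I' = cmat Ir"
  have c: "W \<in> carrier_mat q q" "a11 \<in> carrier_mat r r" "a12 \<in> carrier_mat r q"
    "a21 \<in> carrier_mat q r" "I' \<in> carrier_mat r r"
    using A Ir W by (auto simp: a W_def)
  have WM: "W * (a21 * I' * a12) = 1\<^sub>m q"
    using arg_cong[OF W(3), of cmat] W(1) A Ir by (simp add: W_def a cmat_mult cmat_one)
  have II: "I' * I' = 1\<^sub>m r"
    using arg_cong[OF Ir(2), of cmat] Ir(1) by (simp add: a cmat_mult cmat_one)
  define T where "T = I' * a11 - I' * a12 * (W * (a21 * I' * a11))"
  have T: "T \<in> carrier_mat r r" using c by (intro carrier_matI) (auto simp: T_def)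
  have "det (pencil ?E ?A s) \<noteq> 0" if s: "\<not> eigenvalue T s" for s
  proof
    assume det: "det (pencil ?E ?A s) = 0"
    have P: "pencil ?E ?A s = four_block_mat (s \<cdot>\<^sub>m I' - a11) (- a12) (- a21) (0\<^sub>m q q)"
      using A Ir by (intro eq_matI) (auto simp: pencil_def a)
    have "pencil ?E ?A s \<in> carrier_mat (r + q) (r + q)"
      using c by (intro carrier_matI) (auto simp: P)
    from det_0_iff_vec_prod_zero[OF this] det obtain v where
      v: "v \<in> carrier_vec (r + q)" "v \<noteq> 0\<^sub>v (r + q)" "pencil ?E ?A s *\<^sub>v v = 0\<^sub>v (r + q)" by auto
    define x z where "x = vec_first v r" "z = vec_last v q"
    have vxz: "v = x @\<^sub>v z" and x: "x \<in> carrier_vec r" and z: "z \<in> carrier_vec q"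
      using v(1) by (auto simp: x_z_def)
    have "((s \<cdot>\<^sub>m I' - a11) *\<^sub>v x + (- a12) *\<^sub>v z) @\<^sub>v ((- a21) *\<^sub>v x + 0\<^sub>m q q *\<^sub>v z) = 0\<^sub>v r @\<^sub>v 0\<^sub>v q"
      using v(3) c x z unfolding P vxz by (subst (asm) four_block_mat_mult_vec) auto
    hence top: "(s \<cdot>\<^sub>m I' - a11) *\<^sub>v x + (- a12) *\<^sub>v z = 0\<^sub>v r"
      and bot: "(- a21) *\<^sub>v x + 0\<^sub>m q q *\<^sub>v z = 0\<^sub>v q"
      by (subst (asm) append_vec_eq[of _ r]; use c z in \<open>auto intro!: carrier_vecI\<close>)+
    have a21x: "a21 *\<^sub>v x = 0\<^sub>v q"
    proof (intro eq_vecI)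
      fix i assume "i < dim_vec (0\<^sub>v q :: complex vec)"
      with arg_cong[OF bot, of "\<lambda>v. v $ i"] c x z show "(a21 *\<^sub>v x) $ i = 0\<^sub>v q $ i" by simp
    qed (use c in auto)
    \<comment> \<open>Multiply the upper block row by \<open>I'\<close>, an involution.\<close>
    have sx: "s \<cdot>\<^sub>v x = I' *\<^sub>v (a11 *\<^sub>v x) + I' *\<^sub>v (a12 *\<^sub>v z)"
    proof -
      have "s \<cdot>\<^sub>v (I' *\<^sub>v x) = a11 *\<^sub>v x + a12 *\<^sub>v z"
      proof (intro eq_vecI)
        fix i assume "i < dim_vec (a11 *\<^sub>v x + a12 *\<^sub>v z)"
        hence i: "i < r" using c by simp
        from i c x z have "((s \<cdot>\<^sub>m I' - a11) *\<^sub>v x + (- a12) *\<^sub>v z) $ i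
            = s * (row I' i \<bullet> x) - row a11 i \<bullet> x - row a12 i \<bullet> z"
          by (simp add: minus_mult_distrib_mat_vec[of _ r r])
        hence "s * (row I' i \<bullet> x) = row a11 i \<bullet> x + row a12 i \<bullet> z"
          using i unfolding top by (simp add: algebra_simps)
        with i c x z show "(s \<cdot>\<^sub>v (I' *\<^sub>v x)) $ i = (a11 *\<^sub>v x + a12 *\<^sub>v z) $ i" by simp
      qed (use c in auto)
      hence "I' *\<^sub>v (s \<cdot>\<^sub>v (I' *\<^sub>v x)) = I' *\<^sub>v (a11 *\<^sub>v x + a12 *\<^sub>v z)" by simp
      also have "I' *\<^sub>v (s \<cdot>\<^sub>v (I' *\<^sub>v x)) = s \<cdot>\<^sub>v ((I' * I') *\<^sub>v x)"
        using c x by (simp add: mult_mat_vec[of _ r r] mult_mat_vec_assoc_dims)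
      also have "\<dots> = s \<cdot>\<^sub>v x" using x by (simp add: II)
      also have "I' *\<^sub>v (a11 *\<^sub>v x + a12 *\<^sub>v z) = I' *\<^sub>v (a11 *\<^sub>v x) + I' *\<^sub>v (a12 *\<^sub>v z)"
        using c x z by (intro mult_add_distrib_mat_vec) auto
      finally show ?thesis .
    qed
    define w where "w = W *\<^sub>v (a21 *\<^sub>v (I' *\<^sub>v (a11 *\<^sub>v x)))"
    have w: "w \<in> carrier_vec q" using c by (auto simp: w_def intro: carrier_vecI)
    \<comment> \<open>Multiply by \<open>W a21\<close>, where \<open>W\<close> inverts \<open>a21 I' a12\<close>; this solves for \<open>z\<close>.\<close>
    have "0\<^sub>v q = a21 *\<^sub>v (s \<cdot>\<^sub>v x)" using a21x c x by (auto simp: mult_mat_vec[of _ q r])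
    also have "\<dots> = a21 *\<^sub>v (I' *\<^sub>v (a11 *\<^sub>v x)) + a21 *\<^sub>v (I' *\<^sub>v (a12 *\<^sub>v z))"
      unfolding sx using c x z by (intro mult_add_distrib_mat_vec) auto
    finally have "W *\<^sub>v 0\<^sub>v q = w + W *\<^sub>v (a21 *\<^sub>v (I' *\<^sub>v (a12 *\<^sub>v z)))"
      using c x z by (simp add: mult_add_distrib_mat_vec[of _ q q] w_def)
    also have "W *\<^sub>v (a21 *\<^sub>v (I' *\<^sub>v (a12 *\<^sub>v z))) = W * (a21 * I' * a12) *\<^sub>v z"
      using c z by (simp add: mult_mat_vec_assoc_dims)
    also have "\<dots> = z" using z by (simp add: WM)
    also have "W *\<^sub>v 0\<^sub>v q = 0\<^sub>v q" by (rule mult_mat_zero_vec[OF c(1)])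
    finally have wz: "w + z = 0\<^sub>v q" by simp
    have zw: "z = - w"
    proof (intro eq_vecI)
      fix i assume "i < dim_vec (- w)"
      with w z arg_cong[OF wz, of "\<lambda>v. v $ i"] show "z $ i = (- w) $ i"
        by (simp add: eq_neg_iff_add_eq_0 add.commute)
    qed (use w z in auto)
    have "I' *\<^sub>v (a12 *\<^sub>v w) + I' *\<^sub>v (a12 *\<^sub>v z) = I' *\<^sub>v (a12 *\<^sub>v (w + z))"
      using c w z by (simp add: mult_add_distrib_mat_vec[of _ r q] mult_add_distrib_mat_vec[of _ r r])
    also have "\<dots> = 0\<^sub>v r" by (simp add: wz mult_mat_zero_vec[OF c(3)] mult_mat_zero_vec[OF c(5)])
    finally have cancel: "I' *\<^sub>v (a12 *\<^sub>v w) + I' *\<^sub>v (a12 *\<^sub>v z) = 0\<^sub>v r" .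
    have Tx: "T *\<^sub>v x = I' *\<^sub>v (a11 *\<^sub>v x) - I' *\<^sub>v (a12 *\<^sub>v w)"
      unfolding T_def w_def using c x
      by (subst minus_mult_distrib_mat_vec[of _ r r])
        (auto simp: mult_mat_vec_assoc_dims intro!: carrier_matI)
    have "s \<cdot>\<^sub>v x = T *\<^sub>v x"
    proof (intro eq_vecI)
      fix i assume "i < dim_vec (T *\<^sub>v x)"
      with T c arg_cong[OF cancel, of "\<lambda>v. v $ i"] show "(s \<cdot>\<^sub>v x) $ i = (T *\<^sub>v x) $ i"
        unfolding sx Tx by (simp add: add_eq_0_iff)
    qed (use T x in auto)
    moreover have "x \<noteq> 0\<^sub>v r"
    proof
      assume "x = 0\<^sub>v r"
      hence "w = 0\<^sub>v q"
        using c by (simp add: w_def mult_mat_zero_vec[of _ r r] mult_mat_zero_vec[of _ q r]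
            mult_mat_zero_vec[of _ q q])
      hence "z = 0\<^sub>v q" by (auto simp: zw intro!: eq_vecI)
      with \<open>x = 0\<^sub>v r\<close> v(2) vxz show False by auto
    qed
    ultimately have "eigenvector T x s" using T x by (auto simp: eigenvector_def)
    with s show False by (auto simp: eigenvalue_def)
  qed
  with eventually_not_eigenvalue[OF T] show ?thesis by (auto elim: eventually_mono)
qed

text \<open>The case of empty blocks \<open>A\<^sub>1\<^sub>2\<close> and \<open>A\<^sub>2\<^sub>1\<close>.\<close>

lemma pencil_signature_det:
  assumes Ir: "Ir \<in> carrier_mat r r" "Ir * Ir = 1\<^sub>m r" and A: "A \<in> carrier_mat r r"
  shows "eventually (\<lambda>s. det (pencil Ir A s) \<noteq> 0) at_infinity"
proof -
  have inv: "invertible_mat (0\<^sub>m 0 r * Ir * 0\<^sub>m r 0)"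
    by (auto simp: invertible_mat_def inverts_mat_def intro!: exI[of _ "0\<^sub>m 0 0"])
  have "four_block_mat X (0\<^sub>m r 0) (0\<^sub>m 0 r) (0\<^sub>m 0 0) = X" if "X \<in> carrier_mat r r" for X :: "real mat"
    using that by (intro eq_matI) auto
  with index2_pencil_det[OF Ir A zero_carrier_mat zero_carrier_mat inv] Ir A show ?thesis by simp
qed


section \<open>Transfer matrices and their polynomial parts\<close>

text \<open>\<open>J C = J J B\<^sup>T = B\<^sup>T\<close>, hence \<open>J C (s E - A)\<^sup>-\<^sup>1 B\<close> is a congruence transform of the symmetric matrix
  \<open>(s E - A)\<^sup>-\<^sup>1\<close>.\<close>

lemma reciprocal_resolvent:
  assumes J: "J \<in> carrier_mat m m" "J * J = 1\<^sub>m m"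
    and sym: "symmetric_mat E" "symmetric_mat A"
    and dims: "E \<in> carrier_mat n n" "A \<in> carrier_mat n n" "B \<in> carrier_mat n m"
    and C: "C = J * B\<^sup>T"
    and det: "det (pencil E A s) \<noteq> 0"
  shows "resolvent_transfer E A B C s \<in> carrier_mat m m"
    and "symmetric_mat (cmat J * resolvent_transfer E A B C s)"
proof -
  have pencil: "pencil E A s \<in> carrier_mat n n"
    using dims by (intro carrier_matI) (auto simp: pencil_def)
  have "symmetric_mat (pencil E A s)"
    unfolding symmetric_mat_def
  proof (intro eq_matI)
    fix i j assume "i < dim_row (pencil E A s)" "j < dim_col (pencil E A s)"
    hence ij: "i < n" "j < n" using pencil by auto
    from sym have "E\<^sup>T $$ (i, j) = E $$ (i, j)" "A\<^sup>T $$ (i, j) = A $$ (i, j)"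
      by (simp_all add: symmetric_mat_def)
    thus "(pencil E A s)\<^sup>T $$ (i, j) = pencil E A s $$ (i, j)"
      using ij dims by (simp add: pencil_def)
  qed (use pencil in auto)
  note inv = inv_mat_inverts(1)[OF pencil det] symmetric_inv_mat[OF pencil det this]
  show "resolvent_transfer E A B C s \<in> carrier_mat m m"
    using inv dims J unfolding C resolvent_transfer_def by auto
  have "cmat J * cmat C = (cmat B)\<^sup>T"
  proof -
    have "cmat J * cmat C = cmat (J * (J * B\<^sup>T))" using J dims by (simp add: C cmat_mult)
    also have "J * (J * B\<^sup>T) = J * J * B\<^sup>T" using J(1) dims by (simp add: mult_assoc_dims)
    also have "\<dots> = B\<^sup>T" using J(2) dims by simp
    finally show ?thesis by (simp only: cmat_transpose)
  qed
  moreover have "cmat J * resolvent_transfer E A B C s = (cmat J * cmat C) * inv_mat (pencil E A s) * cmat B"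
    using J(1) dims inv(1) by (simp add: resolvent_transfer_def C mult_assoc_dims)
  ultimately have "cmat J * resolvent_transfer E A B C s = (cmat B)\<^sup>T * inv_mat (pencil E A s) * cmat B"
    by simp
  also have "symmetric_mat \<dots>"
    using symmetric_mat_mult_transpose[OF inv, of "(cmat B)\<^sup>T"] dims by simp
  finally show "symmetric_mat (cmat J * resolvent_transfer E A B C s)" .
qed

lemma at_infinity_complex_neq_bot: "(at_infinity :: complex filter) \<noteq> bot"
proof
  assume "(at_infinity :: complex filter) = bot"
  hence "eventually (\<lambda>s::complex. False) at_infinity" by simp
  then obtain r where "\<And>s::complex. r \<le> norm s \<Longrightarrow> False"
    unfolding eventually_at_infinity by blast
  from this[of "complex_of_real \<bar>r\<bar>"] show False by (simp add: abs_ge_self)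
qed

text \<open>This is why a polynomial part is unique.\<close>

lemma affine_tendsto_0_at_infinity:
  fixes a b :: complex
  assumes lim: "((\<lambda>s. a + s * b) \<longlongrightarrow> 0) at_infinity"
  shows "a = 0" "b = 0"
proof -
  have ev: "eventually (\<lambda>s::complex. s \<noteq> 0) at_infinity"
    by (rule eventually_not_equal_at_infinity)
  have inv: "((\<lambda>s. inverse s :: complex) \<longlongrightarrow> 0) at_infinity" by (rule tendsto_inverse_0)
  have "((\<lambda>s. (a + s * b) * inverse s) \<longlongrightarrow> 0 * 0) at_infinity"
    by (intro tendsto_mult lim inv)
  moreover have "((\<lambda>s. (a + s * b) * inverse s) \<longlongrightarrow> a * 0 + b) at_infinity"
  proof (rule Lim_transform_eventually)
    show "((\<lambda>s. a * inverse s + b) \<longlongrightarrow> a * 0 + b) at_infinity"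
      by (intro tendsto_intros inv)
    show "eventually (\<lambda>s. a * inverse s + b = (a + s * b) * inverse s) at_infinity"
      using ev by eventually_elim (simp add: field_simps)
  qed
  ultimately show b: "b = 0" using tendsto_unique[OF at_infinity_complex_neq_bot] by fastforce
  show "a = 0" using lim tendsto_const_iff[OF at_infinity_complex_neq_bot, of a 0] by (simp add: b)
qed

text \<open>Where \<open>J G(s)\<close> is symmetric, the antisymmetric part of \<open>J (G(s) - M\<^sub>0 - s M\<^sub>1)\<close> is, up to sign, that
  of \<open>J M\<^sub>0 + s J M\<^sub>1\<close>.  Its entries are affine in \<open>s\<close> and tend to zero, so they vanish.\<close>

lemma reciprocal_polynomial_part:
  assumes J: "J \<in> carrier_mat m m"
    and poly: "polynomial_part m G M0 M1"
    and G: "eventually (\<lambda>s. G s \<in> carrier_mat m m \<and> symmetric_mat (cmat J * G s)) at_infinity"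
  shows "symmetric_mat (J * M0)" "symmetric_mat (J * M1)"
proof -
  define K where "K s = G s - (cmat M0 + s \<cdot>\<^sub>m cmat M1)" for s
  from poly have M: "M0 \<in> carrier_mat m m" "M1 \<in> carrier_mat m m"
    and K: "K s \<in> carrier_mat m m"
    and lim: "i < m \<Longrightarrow> j < m \<Longrightarrow> ((\<lambda>s. K s $$ (i, j)) \<longlongrightarrow> 0) at_infinity" for i j s
    by (auto simp: polynomial_part_def strictly_proper_def K_def)
  have JK: "((\<lambda>s. (cmat J * K s) $$ (i, j)) \<longlongrightarrow> 0) at_infinity" if "i < m" "j < m" for i j
  proof -
    have "((\<lambda>s. \<Sum>k<m. cmat J $$ (i, k) * K s $$ (k, j)) \<longlongrightarrow> (\<Sum>k<m. cmat J $$ (i, k) * 0)) at_infinity"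
      by (intro tendsto_sum tendsto_mult tendsto_const lim) (use that in auto)
    moreover have "(cmat J * K s) $$ (i, j) = (\<Sum>k<m. cmat J $$ (i, k) * K s $$ (k, j))" for s
      using that J K[of s] by (auto simp: scalar_prod_def lessThan_atLeast0)
    ultimately show ?thesis by simp
  qed
  have eq: "(J * M0) $$ (i, j) = (J * M0) $$ (j, i) \<and> (J * M1) $$ (i, j) = (J * M1) $$ (j, i)"
    if ij: "i < m" "j < m" for i j
  proof -
    define a where "a = complex_of_real ((J * M0) $$ (j, i) - (J * M0) $$ (i, j))"
    define b where "b = complex_of_real ((J * M1) $$ (j, i) - (J * M1) $$ (i, j))"
    have "((\<lambda>s. (cmat J * K s) $$ (i, j) - (cmat J * K s) $$ (j, i)) \<longlongrightarrow> 0 - 0) at_infinity"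
      by (intro tendsto_diff JK ij)
    moreover have "eventually (\<lambda>s. (cmat J * K s) $$ (i, j) - (cmat J * K s) $$ (j, i) = a + s * b) at_infinity"
      using G
    proof eventually_elim
      case (elim s)
      have "cmat J * K s = cmat J * G s - (cmat (J * M0) + s \<cdot>\<^sub>m cmat (J * M1))"
        unfolding K_def using J M elim
        by (simp add: cmat_mult mult_minus_distrib_mat[of _ m m _ m]
            mult_add_distrib_mat[of _ m m _ m] mult_smult_distrib[of _ m m _ m])
      moreover have "(cmat J * G s) $$ (i, j) = (cmat J * G s) $$ (j, i)"
        using elim J by (intro symmetric_matD[of _ m] ij) auto
      ultimately show ?case
        using ij elim J M by (simp add: a_def b_def algebra_simps del: index_mult_mat(1))
    qed
    ultimately have "((\<lambda>s. a + s * b) \<longlongrightarrow> 0) at_infinity"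
      using Lim_transform_eventually by fastforce
    from affine_tendsto_0_at_infinity[OF this] show ?thesis by (simp add: a_def b_def)
  qed
  show "symmetric_mat (J * M0)" "symmetric_mat (J * M1)"
    unfolding symmetric_mat_def using eq J M by (auto intro!: eq_matI simp del: index_mult_mat(1))
qed


section \<open>Signatures and block skew symmetry\<close>

lemma sign_mat_carrier: "sign_mat p q \<in> carrier_mat (p + q) (p + q)"
  by (simp add: sign_mat_def)

lemma sign_mat_square: "sign_mat p q * sign_mat p q = 1\<^sub>m (p + q)"
proof -
  have "- 0\<^sub>m p q = (0\<^sub>m p q :: real mat)" by (intro eq_matI) auto
  thus ?thesis
    unfolding sign_mat_def by (subst mult_four_block_mat[of _ p p _ q _ q _ _ p _ q]) auto
qed

lemma symmetric_sign_mat: "symmetric_mat (sign_mat p q)"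
  unfolding sign_mat_def
  by (subst symmetric_four_block_iff[of _ p _ q]) (auto simp: symmetric_mat_def transpose_uminus)

text \<open>Multiplication by \<open>diag(I, -I)\<close> negates the lower blocks, which turns the sign in
  \<open>H\<^sub>1\<^sub>2 = -H\<^sub>2\<^sub>1\<^sup>T\<close> into plain symmetry and keeps the diagonal blocks symmetric.\<close>

lemma block_skew_symmetric_if_sign_mat:
  assumes H: "H \<in> carrier_mat (p + p) (p + p)" and sym: "symmetric_mat (cmat (sign_mat p p) * H)"
  shows "block_skew_symmetric H"
proof -
  obtain H11 H12 H21 H22 where split: "split_block H p p = (H11, H12, H21, H22)"
    by (metis prod_cases4)
  from split_block[OF split, of p p] H
  have c: "H11 \<in> carrier_mat p p" "H12 \<in> carrier_mat p p" "H21 \<in> carrier_mat p p" "H22 \<in> carrier_mat p p"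
    and H_eq: "H = four_block_mat H11 H12 H21 H22" by auto
  have "cmat (sign_mat p p) = four_block_mat (1\<^sub>m p) (0\<^sub>m p p) (0\<^sub>m p p) (- 1\<^sub>m p)"
    by (intro eq_matI) (auto simp: sign_mat_def)
  hence "cmat (sign_mat p p) * H = four_block_mat H11 H12 (- H21) (- H22)"
    using c by (simp add: H_eq mult_four_block_mat[of _ p p _ p _ p _ _ p _ p])
  with sym have "symmetric_mat H11" and H21: "- H21 = H12\<^sup>T" and "symmetric_mat (- H22)"
    using symmetric_four_block_iff[of H11 p H12 p "- H21" "- H22"] c by auto
  moreover have "H12 = - H21\<^sup>T"
    using arg_cong[OF H21, of transpose_mat] by (simp add: transpose_uminus)
  ultimately show ?thesis
    unfolding block_skew_symmetric_def using c H_eq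
    by (intro exI[of _ p] exI[of _ H11] exI[of _ H12] exI[of _ H21] exI[of _ H22])
      (auto simp: symmetric_mat_def transpose_uminus)
qed


section \<open>The reciprocity structure of RLC networks\<close>

text \<open>The matrix \<open>J\<close> that relates the outputs of the network to its inputs by \<open>C\<^sub>0 = J B\<^sub>0\<^sup>T\<close>: ports
  at current sources carry the sign \<open>+\<close>, ports at voltage sources the sign \<open>-\<close>.\<close>

definition port_signature :: "ports \<Rightarrow> real mat" where
  "port_signature P = (case P of
     Impedance AI \<Rightarrow> 1\<^sub>m (dim_col AI)
   | Admittance AV \<Rightarrow> - 1\<^sub>m (dim_col AV)
   | Hybrid AI AV \<Rightarrow> sign_mat (dim_col AI) (dim_col AI))"

lemma dim_col_append_rows: "dim_col (A @\<^sub>r B) = dim_col A"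
  by (simp add: append_rows_def)

lemma port_signature:
  assumes "valid_ports nv P"
  shows port_signature_carrier:
      "port_signature P \<in> carrier_mat (dim_col (network_B nL P)) (dim_col (network_B nL P))"
    and port_signature_square:
      "port_signature P * port_signature P = 1\<^sub>m (dim_col (network_B nL P))"
  using assms
  by (cases P; simp add: port_signature_def sign_mat_carrier sign_mat_square dim_col_append_rows Let_def)+

lemma symmetric_core_A:
  assumes "psd_mat (dim_col AG) Gm" "dim_row AL = dim_row AG"
  shows "symmetric_mat (core_A AG Gm AL)"
proof -
  from assms have "symmetric_mat (AG * Gm * AG\<^sup>T)"
    by (intro symmetric_mat_mult_transpose[of _ "dim_col AG"]) (auto simp: psd_mat_def)
  thus ?thesis
    unfolding core_A_def using assms
    by (subst symmetric_four_block_iff[of _ "dim_row AG" _ "dim_col AL"])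
      (auto simp: symmetric_mat_def transpose_uminus psd_mat_def)
qed

lemma symmetric_bordered_A:
  assumes "psd_mat (dim_col AG) Gm" "dim_row AL = dim_row AG" "dim_row AV = dim_row AG"
  shows "symmetric_mat (bordered_A AG Gm AL AV)"
proof -
  have c: "- AV @\<^sub>r 0\<^sub>m (dim_col AL) (dim_col AV) \<in> carrier_mat (dim_row AG + dim_col AL) (dim_col AV)"
    unfolding assms(3)[symmetric] by (intro carrier_append_rows) auto
  have "- AV\<^sup>T @\<^sub>c 0\<^sub>m (dim_col AV) (dim_col AL) = (- AV @\<^sub>r 0\<^sub>m (dim_col AL) (dim_col AV))\<^sup>T"
    by (simp add: append_rows_transpose transpose_uminus)
  moreover have "core_A AG Gm AL \<in> carrier_mat (dim_row AG + dim_col AL) (dim_row AG + dim_col AL)"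
    unfolding core_A_def using assms by (intro four_block_carrier_mat) (auto simp: psd_mat_def)
  ultimately show ?thesis
    unfolding bordered_A_def Let_def using c symmetric_core_A[OF assms(1,2)]
    by (subst symmetric_four_block_iff[of _ "dim_row AG + dim_col AL" _ "dim_col AV"])
      (auto simp: symmetric_mat_def)
qed

lemma symmetric_network_A:
  assumes "psd_mat (dim_col AG) Gm" "incidence_matrix nv AG" "incidence_matrix nv AL"
    and "valid_ports nv P"
  shows "symmetric_mat (network_A AG Gm AL P)"
  using assms
  by (cases P) (auto simp: incidence_matrix_def intro!: symmetric_core_A symmetric_bordered_A)

lemma network_B_dim_row:
  assumes "psd_mat (dim_col AL) Lm" "incidence_matrix nv AC" "valid_ports nv P"
  shows "dim_row (network_B (dim_col AL) P) = dim_row (network_E AC Cm Lm P)"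
  using assms
  by (cases P) (auto simp: append_rows_def core_E_def bordered_E_def Let_def incidence_matrix_def psd_mat_def)

lemma network_C_eq:
  assumes "valid_ports nv P"
  shows "network_C nL P = port_signature P * (network_B nL P)\<^sup>T"
proof (cases P)
  case (Impedance AI)
  thus ?thesis by (simp add: port_signature_def append_rows_def)
next
  case (Admittance AV)
  thus ?thesis
    by (intro eq_matI) (auto simp: port_signature_def append_rows_def append_cols_def Let_def)
next
  case (Hybrid AI AV)
  define p where "p = dim_col AV"
  have p: "dim_col AI = p" using assms by (simp add: Hybrid p_def)
  have B: "network_B nL P = four_block_mat (- AI @\<^sub>r 0\<^sub>m nL p) (0\<^sub>m (dim_row AI + nL) p) (0\<^sub>m p p) (1\<^sub>m p)"
    by (simp add: Hybrid p_def Let_def)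
  have C: "network_C nL P = four_block_mat (- AI\<^sup>T @\<^sub>c 0\<^sub>m p nL) (0\<^sub>m p p) (0\<^sub>m p (dim_row AI + nL)) (- 1\<^sub>m p)"
    by (simp add: Hybrid p_def Let_def)
  have "- AI @\<^sub>r 0\<^sub>m nL p \<in> carrier_mat (dim_row AI + nL) p" using p by auto
  hence BT: "(network_B nL P)\<^sup>T = four_block_mat (- AI\<^sup>T @\<^sub>c 0\<^sub>m p nL) (0\<^sub>m p p) (0\<^sub>m p (dim_row AI + nL)) (1\<^sub>m p)"
    unfolding B using p
    by (subst transpose_four_block_mat) (auto simp: append_rows_transpose transpose_uminus)
  show ?thesis
    unfolding BT C using p
    by (simp add: Hybrid port_signature_def sign_mat_def)
     (subst mult_four_block_mat[of _ p p _ p _ p _ _ "dim_row AI + nL" _ p],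
       auto simp: append_cols_def intro!: carrier_matI)
qed


section \<open>Balanced projection\<close>

text \<open>Entry \<open>(i, j)\<close> of a congruence transform depends only on the columns \<open>i\<close> and \<open>j\<close> of the
  transforming matrix.\<close>

lemma leading_block_congruence:
  fixes M :: "'a :: comm_semiring_0 mat"
  assumes "U1 \<in> carrier_mat k l" "U2 \<in> carrier_mat k l'" "M \<in> carrier_mat k k" "i < l" "j < l"
  shows "(U1\<^sup>T * M * U1) $$ (i, j) = ((U1 @\<^sub>c U2)\<^sup>T * M * (U1 @\<^sub>c U2)) $$ (i, j)"
proof -
  have col: "col (U1 @\<^sub>c U2) i = col U1 i" if "i < l" for i
    using that assms(1,2) by (intro eq_vecI) (auto simp: append_cols_def)
  have ix: "(U\<^sup>T * M * U) $$ (i, j) = col U i \<bullet> (M *\<^sub>v col U j)"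
    if "i < dim_col U" "j < dim_col U" "dim_row U = k" for U
  proof -
    have "(U\<^sup>T * (M * U)) $$ (i, j) = col U i \<bullet> col (M * U) j" using that by simp
    also have "col (M * U) j = M *\<^sub>v col U j" using that assms(3) by (intro col_mult2) auto
    finally show ?thesis using that assms(3) by (simp add: mult_assoc_dims)
  qed
  have "dim_col (U1 @\<^sub>c U2) = l + l'" "dim_row (U1 @\<^sub>c U2) = k"
    using assms by (auto simp: append_cols_def)
  thus ?thesis using ix[of U1] ix[of "U1 @\<^sub>c U2"] assms col by simp
qed

text \<open>Orthogonality of \<open>U\<close> reduces \<open>U\<^sup>T M U\<close> to \<open>\<Sigma>\<close>, so the retained block is \<open>\<Sigma>\<^sub>1\<close>, and scaling it by
  \<open>|\<Sigma>\<^sub>1|\<^sup>-\<^sup>1\<^sup>/\<^sup>2\<close> on both sides leaves the signs.\<close>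

lemma balanced_leading_block:
  fixes M :: "real mat"
  assumes U: "U \<in> carrier_mat k k" "U * U\<^sup>T = 1\<^sub>m k"
    and M: "M \<in> carrier_mat k k" "M = U * mat_diag k sigma * U\<^sup>T"
    and l: "l \<le> k" "\<forall>i<l. sigma i \<noteq> 0"
    and U12: "U1 \<in> carrier_mat k l" "U2 \<in> carrier_mat k (k - l)" "U = U1 @\<^sub>c U2"
    and H: "H = mat_diag l (\<lambda>i. \<bar>sigma i\<bar> powr (- 1 / 2))"
  shows "H * (U1\<^sup>T * M * U1) * H = mat_diag l (\<lambda>i. sgn (sigma i))"
proof -
  have UU: "U\<^sup>T * U = 1\<^sub>m k" using mat_mult_left_right_inverse[OF U(1) _ U(2)] U(1) by simp
  have "U\<^sup>T * M * U = (U\<^sup>T * U) * mat_diag k sigma * (U\<^sup>T * U)"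
    using U(1) by (simp add: M(2) mult_assoc_dims carrier_matD[OF mat_diag_dim])
  hence diag: "U\<^sup>T * M * U = mat_diag k sigma"
    by (simp add: UU left_mult_one_mat[of _ k k] right_mult_one_mat[of _ k k])
  have "U1\<^sup>T * M * U1 = mat_diag l sigma"
  proof (intro eq_matI)
    fix i j assume "i < dim_row (mat_diag l sigma)" "j < dim_col (mat_diag l sigma)"
    hence "i < l" "j < l" by (auto simp: mat_diag_def)
    thus "(U1\<^sup>T * M * U1) $$ (i, j) = mat_diag l sigma $$ (i, j)"
      using leading_block_congruence[OF U12(1,2) M(1)] l(1) diag
      by (simp add: U12(3) mat_diag_def)
  qed (use U12 in \<open>auto simp: mat_diag_def\<close>)
  hence "H * (U1\<^sup>T * M * U1) * H
      = mat_diag l (\<lambda>i. \<bar>sigma i\<bar> powr (- 1 / 2) * sigma i * \<bar>sigma i\<bar> powr (- 1 / 2))"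
    by (simp add: H)
  also have "\<dots> = mat_diag l (\<lambda>i. sgn (sigma i))"
  proof -
    have "\<bar>x\<bar> powr (- 1 / 2) * x * \<bar>x\<bar> powr (- 1 / 2) = sgn x" if "x \<noteq> 0" for x :: real
    proof -
      have "\<bar>x\<bar> powr (- 1 / 2) * \<bar>x\<bar> powr (- 1 / 2) = \<bar>x\<bar> powr (- 1)"
        by (subst powr_add[symmetric]) simp
      also have "\<dots> = 1 / \<bar>x\<bar>" using that by (simp add: powr_minus_divide)
      finally have "\<bar>x\<bar> powr (- 1 / 2) * x * \<bar>x\<bar> powr (- 1 / 2) = x * (1 / \<bar>x\<bar>)"
        by (simp only: mult.commute mult.left_commute)
      thus ?thesis using that by (simp add: sgn_if)
    qed
    thus ?thesis using l(2) by (intro eq_matI) (auto simp: mat_diag_def)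
  qed
  finally show ?thesis .
qed

text \<open>The proof tracks the structure "\<open>E\<close>, \<open>A\<close> symmetric and \<open>C = J B\<^sup>T\<close>" from the network to the system
  on which the algorithm operates, where the index-1 and the index-2 case meet again, and from there
  through the projection by \<open>W\<close>.\<close>

theorem theorem4p2:
  fixes nv nL n m r1 r2 r rbar q N k l :: nat
    and P :: ports
    and Gm Cm Lm AG AC AL :: "real mat"
    and E0 A0 B0 C0 :: "real mat"
    and V A11 A12 A21 A22 B1 B2 C1 C2 :: "real mat"
    and F S A12_1 A12_2 A21_1 A21_2 B2_1 B2_2 C2_1 C2_2 :: "real mat"
    and Ir Ab11 Ab12 Ab21 Bb1 Bb2 Cb1 Cb2 Db0 :: "real mat"
    and Eb Ab Bb Cb Pr M0 M1 :: "real mat"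
    and E D A1 B C X Q U U1 U2 S1 H :: "real mat"
    and sigma :: "nat \<Rightarrow> real"
    and Es As B1t C1t :: "real mat"
    and Gt :: "complex \<Rightarrow> complex mat"
  (* the network *)
  assumes G_psd: "psd_mat (dim_col AG) Gm"
    and C_psd: "psd_mat (dim_col AC) Cm"
    and L_psd: "psd_mat nL Lm"
    and nL: "nL = dim_col AL"
    and inc: "incidence_matrix nv AG" "incidence_matrix nv AC" "incidence_matrix nv AL"
    and ports: "valid_ports nv P"
    and E0: "E0 = network_E AC Cm Lm P"
    and A0: "A0 = network_A AG Gm AL P"
    and B0: "B0 = network_B nL P"
    and C0: "C0 = network_C nL P"
    and dims: "n = dim_row E0" "m = dim_col B0"
    and regular: "regular_pencil n E0 A0"
  (* first transformation *)
    and r1: "r1 = vec_space.rank nv (AC * Cm * AC\<^sup>T)"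
    and r2: "r2 = vec_space.rank nL Lm"
    and r: "r = r1 + r2"
    and Ir: "Ir = sign_mat r1 r2"
    and V: "V \<in> carrier_mat n n" "invertible_mat V"
    and E0_ldl: "E0 = V * four_block_mat Ir (0\<^sub>m r (n - r)) (0\<^sub>m (n - r) r) (0\<^sub>m (n - r) (n - r)) * V\<^sup>T"
    and A_carrier: "A11 \<in> carrier_mat r r" "A12 \<in> carrier_mat r (n - r)"
      "A21 \<in> carrier_mat (n - r) r" "A22 \<in> carrier_mat (n - r) (n - r)"
    and A_blocks: "inv_mat V * A0 * (inv_mat V)\<^sup>T = four_block_mat A11 A12 A21 A22"
    and B_carrier: "B1 \<in> carrier_mat r m" "B2 \<in> carrier_mat (n - r) m"
    and B_blocks: "inv_mat V * B0 = B1 @\<^sub>r B2"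
    and C_carrier: "C1 \<in> carrier_mat m r" "C2 \<in> carrier_mat m (n - r)"
    and C_blocks: "C0 * (inv_mat V)\<^sup>T = C1 @\<^sub>c C2"
  (* second transformation *)
    and q: "n = r + rbar + q"
    and F: "F \<in> carrier_mat (n - r) (n - r)" "invertible_mat F"
    and S: "S \<in> carrier_mat rbar rbar" "invertible_mat S" "symmetric_mat S"
    and A22_ldl: "A22 = F * four_block_mat S (0\<^sub>m rbar q) (0\<^sub>m q rbar) (0\<^sub>m q q) * F\<^sup>T"
    and A12_carrier: "A12_1 \<in> carrier_mat r rbar" "A12_2 \<in> carrier_mat r q"
    and A12_blocks: "A12 * (inv_mat F)\<^sup>T = A12_1 @\<^sub>c A12_2"
    and A21_carrier: "A21_1 \<in> carrier_mat rbar r" "A21_2 \<in> carrier_mat q r"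
    and A21_blocks: "inv_mat F * A21 = A21_1 @\<^sub>r A21_2"
    and B2_carrier: "B2_1 \<in> carrier_mat rbar m" "B2_2 \<in> carrier_mat q m"
    and B2_blocks: "inv_mat F * B2 = B2_1 @\<^sub>r B2_2"
    and C2_carrier: "C2_1 \<in> carrier_mat m rbar" "C2_2 \<in> carrier_mat m q"
    and C2_blocks: "C2 * (inv_mat F)\<^sup>T = C2_1 @\<^sub>c C2_2"
    and Ab11: "Ab11 = A11 - A12_1 * inv_mat S * A21_1"
    and Ab12: "Ab12 = A12_2"
    and Ab21: "Ab21 = A21_2"
    and Bb1: "Bb1 = B1 - A12_1 * inv_mat S * B2_1"
    and Bb2: "Bb2 = B2_2"
    and Cb1: "Cb1 = C1 - C2_1 * inv_mat S * A21_1"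
    and Cb2: "Cb2 = C2_2"
    and Db0: "Db0 = - (C2_1 * inv_mat S * B2_1)"
  (* index 2 or index 1 *)
    and index_cases:
      "(\<not> invertible_mat A22 \<and> invertible_mat (Ab21 * Ir * Ab12) \<and>
        N = r + q \<and>
        Eb = four_block_mat Ir (0\<^sub>m r q) (0\<^sub>m q r) (0\<^sub>m q q) \<and>
        Ab = four_block_mat Ab11 Ab12 Ab21 (0\<^sub>m q q) \<and>
        Bb = Bb1 @\<^sub>r Bb2 \<and> Cb = Cb1 @\<^sub>c Cb2 \<and>
        Pr = proj_P_r Ir Ab11 Ab12 Ab21 \<and>
        polynomial_part m (\<lambda>s. resolvent_transfer Eb Ab Bb Cb s + cmat Db0) M0 M1)
       \<or>
       (invertible_mat A22 \<and>
        N = r \<and> Eb = Ir \<and> Ab = Ab11 \<and> Bb = Bb1 \<and> Cb = Cb1 \<and>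
        Pr = 1\<^sub>m r \<and> M0 = Db0 \<and> M1 = 0\<^sub>m m m)"
    and M0_pd: "pd_mat m (M0 + M0\<^sup>T)"
  (* the algorithm *)
    and E: "E = Eb"
    and D: "dim_row D = m" "D * D\<^sup>T = inv_mat (M0 + M0\<^sup>T)"
    and A1: "A1 = Ab - Bb * D * D\<^sup>T * Cb * Pr"
    and B: "B = Bb * D"
    and C: "C = D\<^sup>T * Cb"
    and X: "psd_mat N X"
    and riccati: "A1\<^sup>T * X * E + E\<^sup>T * X * A1 + E\<^sup>T * X * B * B\<^sup>T * X * E
        + Pr\<^sup>T * C\<^sup>T * C * Pr = 0\<^sub>m N N"
    and Q: "Q \<in> carrier_mat N k" "X = Q * Q\<^sup>T"
    and U: "U \<in> carrier_mat k k" "U * U\<^sup>T = 1\<^sub>m k"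
    and eig: "Q\<^sup>T * Eb * Q = U * mat_diag k sigma * U\<^sup>T"
    and descending: "\<forall>i j. i \<le> j \<longrightarrow> j < k \<longrightarrow> \<bar>sigma j\<bar> \<le> \<bar>sigma i\<bar>"
    and retained: "l \<le> k" "\<forall>i<l. sigma i \<noteq> 0"
    and U_carrier: "U1 \<in> carrier_mat k l" "U2 \<in> carrier_mat k (k - l)"
    and U_blocks: "U = U1 @\<^sub>c U2"
    and S1: "S1 = mat_diag l (\<lambda>i. sgn (sigma i))"
    and H: "H = mat_diag l (\<lambda>i. \<bar>sigma i\<bar> powr (- 1 / 2))"
    and Es: "Es = H * U1\<^sup>T * Q\<^sup>T * Eb * Q * U1 * H"
    and As: "As = H * U1\<^sup>T * Q\<^sup>T * Ab * Q * U1 * H"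
    and B1t: "B1t = H * U1\<^sup>T * Q\<^sup>T * Bb"
    and C1t: "C1t = Cb * Q * U1 * S1 * H"
    and Gt: "\<And>s. Gt s = resolvent_transfer Es As B1t (C1t * S1) s + cmat M0 + s \<cdot>\<^sub>m cmat M1"
  shows "regular_pencil l Es As \<and>
    (\<forall>s. det (pencil Es As s) \<noteq> 0 \<longrightarrow>
       (case P of
          Impedance AI \<Rightarrow> symmetric_mat (Gt s)
        | Admittance AV \<Rightarrow> symmetric_mat (Gt s)
        | Hybrid AI AV \<Rightarrow> block_skew_symmetric (Gt s)))"
proof -
  define J where "J = port_signature P"
  note dim_B0 = network_B_dim_row[OF L_psd[unfolded nL] inc(2) ports, of Cm, folded nL E0 B0 dims]
  have B0_c: "B0 \<in> carrier_mat n m"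
    using dim_B0 dims(2) B0 by (intro carrier_matI) simp_all
  have J: "J \<in> carrier_mat m m" "J * J = 1\<^sub>m m"
    using port_signature[OF ports, of nL] by (simp_all add: J_def dims(2) B0)
  have C0_eq: "C0 = J * B0\<^sup>T"
    unfolding C0 J_def B0 by (rule network_C_eq[OF ports])
  have A0_c: "A0 \<in> carrier_mat n n" using regular by (simp add: regular_pencil_def)
  have A0_sym: "symmetric_mat A0"
    unfolding A0 by (rule symmetric_network_A[OF G_psd inc(1,3) ports])

  note Vi = inv_mat_inverts(1)[OF V(1) invertible_mat_det[OF V]]
  have "symmetric_mat (four_block_mat A11 A12 A21 A22)"
    unfolding A_blocks[symmetric] using Vi by (intro symmetric_mat_mult_transpose[OF A0_c A0_sym]) auto
  hence A11_sym: "symmetric_mat A11" and A21_eq: "A21 = A12\<^sup>T"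
    by (auto simp: symmetric_four_block_iff[OF A_carrier])
  note C12 = reciprocal_ports_split[OF J(1) Vi B0_c C0_eq B_blocks C_blocks B_carrier C_carrier]

  note Fi = inv_mat_inverts(1)[OF F(1) invertible_mat_det[OF F]]
  note C2_12 = reciprocal_ports_split[OF J(1) Fi B_carrier(2) C12(2) B2_blocks C2_blocks B2_carrier C2_carrier]
  \<comment> \<open>The off-diagonal blocks are treated as ports with signature \<open>I\<close>.\<close>
  have "A12 = 1\<^sub>m r * A21\<^sup>T" using A_carrier by (simp add: A21_eq)
  note A12_12 = reciprocal_ports_split[OF one_carrier_mat Fi A_carrier(3) this A21_blocks A12_blocks
      A21_carrier A12_carrier]
  have A21_1: "A21_1 = A12_1\<^sup>T" and A21_2: "A21_2 = A12_2\<^sup>T"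
    using A12_12 A21_carrier by simp_all
  note Si = inv_mat_inverts(1)[OF S(1) invertible_mat_det[OF S(1,2)]]
    symmetric_inv_mat[OF S(1) invertible_mat_det[OF S(1,2)] S(3)]

  have Cb1_eq: "Cb1 = J * Bb1\<^sup>T"
    unfolding Cb1 Bb1
    by (rule reciprocal_schur[OF J(1) Si B_carrier(1) B2_carrier(1) A12_carrier(1) C12(1) C2_12(1) A21_1])
  have Cb2_eq: "Cb2 = J * Bb2\<^sup>T" unfolding Cb2 Bb2 by (rule C2_12(2))
  have JDb0: "symmetric_mat (J * Db0)"
    unfolding Db0 by (rule reciprocal_feedthrough[OF J Si B2_carrier(1) C2_12(1)])
  have Ab11_sym: "symmetric_mat Ab11"
  proof -
    have "A12_1 * inv_mat S * A12_1\<^sup>T \<in> carrier_mat r r" using A12_carrier Si(1) by auto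
    moreover have "symmetric_mat (A12_1 * inv_mat S * A12_1\<^sup>T)"
      using A12_carrier by (intro symmetric_mat_mult_transpose[OF Si]) auto
    ultimately show ?thesis
      using A11_sym A_carrier(1) by (simp add: Ab11 A21_1 symmetric_mat_def transpose_minus[of _ r r])
  qed
  have c: "Ab11 \<in> carrier_mat r r" "Ab12 \<in> carrier_mat r q" "Ab21 \<in> carrier_mat q r"
    "Bb1 \<in> carrier_mat r m" "Bb2 \<in> carrier_mat q m" "Db0 \<in> carrier_mat m m"
    using A_carrier A12_carrier A21_carrier B_carrier B2_carrier C2_carrier Si(1)
    by (auto simp: Ab11 Ab12 Ab21 Bb1 Bb2 Db0 intro!: carrier_matI)
  have Ir_c: "Ir \<in> carrier_mat r r" and Ir2: "Ir * Ir = 1\<^sub>m r" and Ir_sym: "symmetric_mat Ir"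
    by (simp_all add: Ir r sign_mat_carrier sign_mat_square symmetric_sign_mat)

  have Eb: "Eb \<in> carrier_mat N N" "symmetric_mat Eb"
    and Ab: "Ab \<in> carrier_mat N N" "symmetric_mat Ab"
    and Bb: "Bb \<in> carrier_mat N m" and Cb: "Cb = J * Bb\<^sup>T"
    and M0: "M0 \<in> carrier_mat m m" "symmetric_mat (J * M0)"
    and M1: "M1 \<in> carrier_mat m m" "symmetric_mat (J * M1)"
  proof -
    have "Eb \<in> carrier_mat N N \<and> symmetric_mat Eb \<and> Ab \<in> carrier_mat N N \<and> symmetric_mat Ab \<and>
      Bb \<in> carrier_mat N m \<and> Cb = J * Bb\<^sup>T \<and> M0 \<in> carrier_mat m m \<and> symmetric_mat (J * M0) \<and>
      M1 \<in> carrier_mat m m \<and> symmetric_mat (J * M1)"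
      using index_cases
    proof (elim disjE conjE)
      assume inv: "invertible_mat (Ab21 * Ir * Ab12)" and N: "N = r + q"
        and Eb: "Eb = four_block_mat Ir (0\<^sub>m r q) (0\<^sub>m q r) (0\<^sub>m q q)"
        and Ab: "Ab = four_block_mat Ab11 Ab12 Ab21 (0\<^sub>m q q)"
        and Bb: "Bb = Bb1 @\<^sub>r Bb2" and Cb: "Cb = Cb1 @\<^sub>c Cb2"
        and poly: "polynomial_part m (\<lambda>s. resolvent_transfer Eb Ab Bb Cb s + cmat Db0) M0 M1"
      have Eb': "Eb \<in> carrier_mat N N" "symmetric_mat Eb"
        unfolding Eb N using Ir_c Ir_sym symmetric_four_block_iff[of Ir r "0\<^sub>m r q" q "0\<^sub>m q r" "0\<^sub>m q q"]
        by (auto simp: symmetric_mat_def)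
      have Ab': "Ab \<in> carrier_mat N N" "symmetric_mat Ab"
        unfolding Ab N using c Ab11_sym symmetric_four_block_iff[of Ab11 r Ab12 q Ab21 "0\<^sub>m q q"]
        by (auto simp: symmetric_mat_def Ab12 Ab21 A21_2)
      have Bb': "Bb \<in> carrier_mat N m" unfolding Bb N using c by auto
      have Cb': "Cb = J * Bb\<^sup>T"
        unfolding Cb Bb Cb1_eq Cb2_eq using c J(1)
        by (simp add: append_rows_transpose mult_append_cols)
      have M: "M0 \<in> carrier_mat m m" "M1 \<in> carrier_mat m m" using poly by (simp_all add: polynomial_part_def)
      have "eventually (\<lambda>s. resolvent_transfer Eb Ab Bb Cb s + cmat Db0 \<in> carrier_mat m m \<and>
          symmetric_mat (cmat J * (resolvent_transfer Eb Ab Bb Cb s + cmat Db0))) at_infinity"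
        using index2_pencil_det[OF Ir_c Ir2 c(1-3) inv, folded Eb Ab]
      proof eventually_elim
        case (elim s)
        note G = reciprocal_resolvent[OF J Eb'(2) Ab'(2) Eb'(1) Ab'(1) Bb' Cb' elim]
        have "cmat J * (resolvent_transfer Eb Ab Bb Cb s + cmat Db0)
            = cmat J * resolvent_transfer Eb Ab Bb Cb s + cmat (J * Db0)"
          using J(1) G(1) c(6) by (simp add: cmat_mult mult_add_distrib_mat[of _ m m _ m])
        moreover have "symmetric_mat \<dots>"
          using G J(1) c(6) symmetric_cmat[OF JDb0] by (intro symmetric_mat_add[of _ m]) auto
        ultimately show ?case using G(1) c(6) by simp
      qed
      from reciprocal_polynomial_part[OF J(1) poly this] show ?thesis
        using Eb' Ab' Bb' Cb' M by simp
    next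
      assume "N = r" "Eb = Ir" "Ab = Ab11" "Bb = Bb1" "Cb = Cb1" "M0 = Db0" "M1 = 0\<^sub>m m m"
      thus ?thesis using c Ir_c Ir_sym Ab11_sym Cb1_eq JDb0 J by (simp add: symmetric_mat_def)
    qed
    thus "Eb \<in> carrier_mat N N" "symmetric_mat Eb" "Ab \<in> carrier_mat N N" "symmetric_mat Ab"
      "Bb \<in> carrier_mat N m" "Cb = J * Bb\<^sup>T" "M0 \<in> carrier_mat m m" "symmetric_mat (J * M0)"
      "M1 \<in> carrier_mat m m" "symmetric_mat (J * M1)" by blast+
  qed

  define W where "W = Q * U1 * H"
  have H_c: "H \<in> carrier_mat l l" and S1_c: "S1 \<in> carrier_mat l l" by (simp_all add: H S1)
  have H_sym: "H\<^sup>T = H" by (intro eq_matI) (auto simp: H mat_diag_def)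
  have W_c: "W \<in> carrier_mat N l" unfolding W_def using Q(1) U_carrier(1) H_c by auto
  have WT: "W\<^sup>T = H * U1\<^sup>T * Q\<^sup>T"
    using Q(1) U_carrier(1) H_c by (simp add: W_def transpose_mult_dims mult_assoc_dims H_sym)
  have Es_W: "Es = W\<^sup>T * Eb * W" and As_W: "As = W\<^sup>T * Ab * W" and B1t_W: "B1t = W\<^sup>T * Bb"
    unfolding Es As B1t WT unfolding W_def using Q(1) U_carrier(1) H_c Eb Ab Bb
    by (simp_all add: mult_assoc_dims)
  have As_c: "As \<in> carrier_mat l l" unfolding As_W using W_c by (auto intro!: carrier_matI)
  have B1t_c: "B1t \<in> carrier_mat l m" unfolding B1t_W using W_c Bb by (auto intro!: carrier_matI)
  have As_sym: "symmetric_mat As"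
    unfolding As_W using symmetric_mat_mult_transpose[of Ab N "W\<^sup>T"] Ab W_c by simp

  have Es_S1: "Es = S1"
  proof -
    have "Es = H * (U1\<^sup>T * (Q\<^sup>T * Eb * Q) * U1) * H"
      unfolding Es using Q(1) U_carrier(1) H_c Eb by (simp add: mult_assoc_dims)
    also have "\<dots> = S1"
      unfolding S1 using Q(1)
      by (intro balanced_leading_block[OF U _ eig retained U_carrier U_blocks H]) (auto intro!: carrier_matI)
    finally show ?thesis .
  qed
  have S1_sq: "S1 * S1 = 1\<^sub>m l"
    using retained(2) unfolding S1 mat_diag_diag
    by (intro eq_matI) (auto simp: mat_diag_def sgn_if)
  have S1_sym: "symmetric_mat S1"
    unfolding symmetric_mat_def by (intro eq_matI) (auto simp: S1 mat_diag_def)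

  have C1t_W: "C1t * S1 = J * B1t\<^sup>T"
  proof -
    have "S1 * H * S1 = H"
      using retained(2) unfolding S1 H mat_diag_diag
      by (intro eq_matI) (auto simp: mat_diag_def sgn_if)
    hence "Cb * Q * U1 * (S1 * H * S1) = Cb * Q * U1 * H" by simp
    hence "C1t * S1 = Cb * W"
      unfolding C1t W_def using Q(1) U_carrier(1) H_c S1_c Bb J(1) Cb by (simp add: mult_assoc_dims)
    also have "\<dots> = J * B1t\<^sup>T"
      unfolding B1t_W Cb using Bb W_c J(1) by (simp add: transpose_mult_dims mult_assoc_dims)
    finally show ?thesis .
  qed

  have "eventually (\<lambda>s. det (pencil Es As s) \<noteq> 0) at_infinity"
    unfolding Es_S1 by (rule pencil_signature_det[OF S1_c S1_sq As_c])
  hence "\<exists>s. det (pencil Es As s) \<noteq> 0"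
    using at_infinity_complex_neq_bot eventually_happens by blast
  hence regular': "regular_pencil l Es As"
    using S1_c As_c by (simp add: regular_pencil_def Es_S1)

  have "case P of Impedance AI \<Rightarrow> symmetric_mat (Gt s) | Admittance AV \<Rightarrow> symmetric_mat (Gt s)
      | Hybrid AI AV \<Rightarrow> block_skew_symmetric (Gt s)" if det: "det (pencil Es As s) \<noteq> 0" for s
  proof -
    note G = reciprocal_resolvent[OF J S1_sym[folded Es_S1] As_sym S1_c[folded Es_S1] As_c B1t_c C1t_W det]
    have Gt_c: "Gt s \<in> carrier_mat m m" using G(1) M0 M1 by (simp add: Gt)
    have "cmat J * Gt s
        = cmat J * resolvent_transfer Es As B1t (C1t * S1) s + (cmat (J * M0) + s \<cdot>\<^sub>m cmat (J * M1))"
      using J(1) G(1) M0 M1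
      by (simp add: Gt cmat_mult mult_add_distrib_mat[of _ m m _ m] mult_smult_distrib[of _ m m _ m])
    moreover have "symmetric_mat \<dots>"
      using G J(1) M0 M1
      by (intro symmetric_mat_add[of _ m] symmetric_mat_smult symmetric_cmat) auto
    ultimately have sym: "symmetric_mat (cmat J * Gt s)" by simp
    show ?thesis
    proof (cases P)
      case (Impedance AI)
      hence "J = 1\<^sub>m m" using J(1) by (auto simp: J_def port_signature_def)
      thus ?thesis using sym Gt_c by (simp add: Impedance cmat_one)
    next
      case (Admittance AV)
      hence "J = - 1\<^sub>m m" using J(1) by (auto simp: J_def port_signature_def)
      moreover have "cmat (- 1\<^sub>m m) = - 1\<^sub>m m" by (intro eq_matI) auto
      ultimately show ?thesis
        using sym Gt_c by (simp add: Admittance symmetric_mat_def transpose_uminus)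
    next
      case (Hybrid AI AV)
      define p where "p = dim_col AI"
      have "J = sign_mat p p" using Hybrid by (simp add: J_def port_signature_def p_def)
      moreover from this have "m = p + p" using J(1) sign_mat_carrier[of p p] by auto
      ultimately show ?thesis
        using block_skew_symmetric_if_sign_mat[of "Gt s" p] sym Gt_c by (simp add: Hybrid)
    qed
  qed
  with regular' show ?thesis by blast
qed

end
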